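(* Let $K$ be an algebraically closed field of characteristic three. Any cubic rational expression $R(x)$ over $K$ is equivalent to either $x^3$, or $x^3+x^2$, or $x^3+x$, or \[R_c(x):=\frac{x^3+(c+1)x^2}{-(c+1)x-c}\] for some $c\in K\setminus\mathbb F_3$.
   Context: A rational expression $R(x)=g(x)/h(x)\in K(x)$ with $g,h$ coprime has degree $\max(\deg g,\deg h)$; cubic means degree $3$. The group $G(K)=\mathrm{PGL}_2(K)\times\mathrm{PGL}_2(K)$, with $\mathrm{PGL}_2(K)$ identified with the group of degree-one rational expressions (Möbius transformations) under composition, acts on $K(x)$ by $(B,A)\cdot R(x)=B(R(A^{-1}(x)))$; two rational expressions are equivalent if they lie in the same $G(K)$-orbit. *)

theory Defs
  imports
    "HOL-Computational_Algebra.Polynomial_Factorial"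
    "HOL-Algebra.Group_Action"
begin

text \<open>
  The field \<open>K(x)\<close> of rational expressions is \<open>'a poly fract\<close>, with \<open>'a\<close> in the role of \<open>K\<close>.
  The library's normalised fractions need a \<open>gcd\<close> structure on the coefficients, which an arbitrary
  field does not carry, so reduced representations are introduced by hand.
\<close>

definition rat_const :: "'a::field \<Rightarrow> 'a poly fract"
  where "rat_const c = to_fract [:c:]"

definition rat_X :: "'a::field poly fract"
  where "rat_X = to_fract [:0, 1:]"

definition reduced_repr :: "'a::field poly fract \<Rightarrow> 'a poly \<times> 'a poly \<Rightarrow> bool"
  where "reduced_repr R = (\<lambda>(g, h). h \<noteq> 0 \<and> coprime g h \<and> R = Fract g h)"

text \<open>The choice below is only unique up to a common nonzero constant factor; the lemmas
  \<open>rat_degree_eq\<close> and \<open>rat_comp_Fract\<close> show that nothing defined from it depends on the choice.\<close>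

definition rat_repr :: "'a::field poly fract \<Rightarrow> 'a poly \<times> 'a poly"
  where "rat_repr R = (SOME p. reduced_repr R p)"

definition rat_degree :: "'a::field poly fract \<Rightarrow> nat"
  where "rat_degree R = (case rat_repr R of (g, h) \<Rightarrow> max (degree g) (degree h))"

definition rat_eval :: "'a::field poly \<Rightarrow> 'a poly fract \<Rightarrow> 'a poly fract"
  where "rat_eval p S = poly (map_poly rat_const p) S"

text \<open>Composition \<open>R(S(x))\<close>. It is meaningful for nonconstant \<open>S\<close>, where the
  denominator below is nonzero; if \<open>S\<close> is a constant at which \<open>R\<close> has a pole,
  the totalised division returns \<open>0\<close>. Nonconstant expressions are closed under
  composition (\<open>rat_comp_nonconst\<close>), so this never interferes with the orbit of one.\<close>

definition rat_comp :: "'a::field poly fract \<Rightarrow> 'a poly fract \<Rightarrow> 'a poly fract"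
  where "rat_comp R S = (case rat_repr R of (g, h) \<Rightarrow> rat_eval g S / rat_eval h S)"

text \<open>The group \<open>PGL\<^sub>2(K)\<close>, identified with the degree-one rational expressions under composition;
  \<open>group_PGL2\<close> shows that it is a group, so that \<open>inv\<close> is the compositional inverse.\<close>

definition PGL2 :: "'a::field poly fract monoid"
  where "PGL2 = \<lparr>carrier = {A. rat_degree A = 1}, mult = rat_comp, one = rat_X\<rparr>"

definition PGL2_action :: "'a::field poly fract \<times> 'a poly fract \<Rightarrow> 'a poly fract \<Rightarrow> 'a poly fract"
  where "PGL2_action = (\<lambda>(B, A) R. rat_comp B (rat_comp R (inv\<^bsub>PGL2\<^esub> A)))"

definition rat_equivalent :: "'a::field poly fract \<Rightarrow> 'a poly fract \<Rightarrow> bool"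
  where "rat_equivalent R S \<longleftrightarrow> S \<in> orbit (PGL2 \<times>\<times> PGL2) PGL2_action R"

definition R_c :: "'a::field \<Rightarrow> 'a poly fract"
  where "R_c c = (rat_X ^ 3 + rat_const (c + 1) * rat_X ^ 2) /
                 (- rat_const (c + 1) * rat_X - rat_const c)"


text \<open>The library's versions of the next two facts need a \<open>gcd\<close> operation.\<close>

lemma coprime_poly_bezout:
  fixes g h :: "'a::field poly"
  assumes "coprime g h"
  shows "\<exists>u v. u * g + v * h = 1"
  using assms
proof (induction "euclidean_size h" arbitrary: g h rule: less_induct)
  case less
  show ?case
  proof (cases "h = 0")
    case True
    with less.prems have "g dvd 1" by simp
    then obtain u where "1 = g * u" by (rule dvdE)
    thus ?thesis using True by (intro exI[of _ u] exI[of _ 0]) (simp add: mult.commute)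
  next
    case False
    have "coprime h (g mod h)"
    proof (rule coprimeI)
      fix d assume "d dvd h" "d dvd g mod h"
      thus "is_unit d" using less.prems coprime_common_divisor dvd_mod_imp_dvd by blast
    qed
    then obtain u v where "u * h + v * (g mod h) = 1"
      using less.hyps[of "g mod h" h] False mod_size_less by blast
    hence "v * g + (u - v * (g div h)) * h = 1"
      unfolding minus_div_mult_eq_mod[symmetric] by (simp add: algebra_simps)
    thus ?thesis by blast
  qed
qed

lemma coprime_poly_dvd_mult:
  fixes g h b :: "'a::field poly"
  assumes "coprime g h" "h dvd g * b"
  shows "h dvd b"
proof -
  obtain u v where "u * g + v * h = 1" using coprime_poly_bezout[OF assms(1)] by blast
  hence "b = (u * g + v * h) * b" by simp
  also have "\<dots> = u * (g * b) + h * (v * b)" by (simp add: algebra_simps)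
  finally have b: "b = u * (g * b) + h * (v * b)" .
  show ?thesis by (subst b) (intro dvd_add dvd_mult[OF assms(2)] dvd_triv_left)
qed

lemma reduced_repr_exists: "\<exists>p. reduced_repr (R :: 'a::field poly fract) p"
proof -
  define P where "P = (\<lambda>n. \<exists>g h. h \<noteq> 0 \<and> R = Fract g h \<and> degree h = n)"
  have "\<exists>n. P n" unfolding P_def by (cases R) auto
  then obtain n where n: "P n" "\<And>m. P m \<Longrightarrow> n \<le> m"
    by (metis LeastI_ex Least_le)
  then obtain g h where gh: "h \<noteq> 0" "R = Fract g h" "degree h = n" unfolding P_def by blast
  have "coprime g h"
  proof (rule coprimeI)
    fix d assume d: "d dvd g" "d dvd h"
    then obtain g' h' where e: "g = d * g'" "h = d * h'" by (auto elim!: dvdE)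
    with gh have nz: "d \<noteq> 0" "h' \<noteq> 0" by auto
    have "R = Fract g' h'" using gh e nz by (simp add: eq_fract)
    hence "P (degree h')" unfolding P_def using nz by blast
    hence "n \<le> degree h'" by (rule n(2))
    moreover have "n = degree d + degree h'" using gh e nz by (simp add: degree_mult_eq)
    ultimately have "degree d = 0" by simp
    thus "is_unit d" using nz by (simp add: is_unit_iff_degree)
  qed
  thus ?thesis using gh unfolding reduced_repr_def by auto
qed

lemma rat_repr: "reduced_repr R (rat_repr R)"
  unfolding rat_repr_def by (rule someI_ex[OF reduced_repr_exists])

lemma rat_reprE:
  obtains g h where "rat_repr R = (g, h)" "h \<noteq> 0" "coprime g h" "R = Fract g h"
  using rat_repr[of R] that by (cases "rat_repr R") (auto simp: reduced_repr_def)

lemma rat_degree_eq: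
  assumes "coprime g h" "h \<noteq> 0"
  shows "rat_degree (Fract g h) = max (degree g) (degree h)"
proof -
  obtain a b where r: "rat_repr (Fract g h) = (a, b)" "b \<noteq> 0" "coprime a b" "Fract g h = Fract a b"
    by (rule rat_reprE)
  have eq: "g * b = a * h" using r assms by (simp add: eq_fract)
  have "h dvd g * b" "b dvd a * h" using eq by (metis dvd_triv_right)+
  note coprime_poly_dvd_mult[OF assms(1) this(1)] coprime_poly_dvd_mult[OF r(3) this(2)]
  hence d1: "degree b = degree h"
    using assms(2) r(2) by (simp add: dvd_imp_degree_le dual_order.antisym)
  have "degree g = degree a"
  proof (cases "g = 0")
    case True thus ?thesis using eq assms by simp
  next
    case False
    hence "a \<noteq> 0" using eq r by auto
    thus ?thesis using arg_cong[OF eq, of degree] False assms(2) r(2) d1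
      by (simp add: degree_mult_eq)
  qed
  thus ?thesis unfolding rat_degree_def r(1) using d1 by simp
qed

lemma rat_const_simps [simp]:
  "rat_const 0 = 0" "rat_const 1 = 1"
  "rat_const (a + b) = rat_const a + rat_const b"
  "rat_const (a * b) = rat_const a * rat_const b"
  by (simp_all add: rat_const_def to_fract_def Zero_fract_def One_fract_def one_pCons mult.commute)

lemma rat_const_eq_0_iff [simp]: "rat_const c = 0 \<longleftrightarrow> c = 0"
  by (simp add: rat_const_def)

lemma rat_eval_0 [simp]: "rat_eval 0 S = 0"
  by (simp add: rat_eval_def)

lemma rat_eval_pCons [simp]: "rat_eval (pCons a p) S = rat_const a + S * rat_eval p S"
  by (simp add: rat_eval_def map_poly_pCons)

lemma rat_eval_add [simp]: "rat_eval (p + q) S = rat_eval p S + rat_eval q S"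
  by (induction p q rule: poly_induct2) (simp_all add: algebra_simps)

lemma rat_eval_smult [simp]: "rat_eval (smult c p) S = rat_const c * rat_eval p S"
  by (induction p) (simp_all add: algebra_simps)

lemma rat_eval_mult [simp]: "rat_eval (p * q) S = rat_eval p S * rat_eval q S"
  by (induction p) (simp_all add: algebra_simps)

lemma rat_eval_to_fract: "rat_eval p (to_fract g) = to_fract (pcompose p g)"
  by (induction p) (simp_all add: pcompose_pCons rat_const_def)

lemma rat_eval_X: "rat_eval p rat_X = to_fract p"
  unfolding rat_X_def rat_eval_to_fract by (simp add: pcompose_idR)

lemma rat_eval_eq_0_imp:
  assumes S: "S \<notin> range rat_const" and "rat_eval p S = 0"
  shows "p = 0"
proof (rule ccontr)
  assume "p \<noteq> 0"
  obtain g h where r: "h \<noteq> 0" "coprime g h" "S = Fract g h" by (rule rat_reprE)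
  have Sh: "S * to_fract h = to_fract g" using r by (simp add: to_fract_def eq_fract)
  have key: "\<exists>w. to_fract (h ^ degree q) * rat_eval q S = to_fract (smult (lead_coeff q) (g ^ degree q) + h * w)"
    for q
  proof (induction q)
    case 0 show ?case by (auto intro: exI[of _ 0])
  next
    case (pCons a q)
    show ?case
    proof (cases "q = 0")
      case True thus ?thesis by (auto intro!: exI[of _ 0] simp: rat_const_def)
    next
      case False
      obtain w where w: "to_fract (h ^ degree q) * rat_eval q S
          = to_fract (smult (lead_coeff q) (g ^ degree q) + h * w)" using pCons.IH by blast
      have "to_fract (h ^ degree (pCons a q)) * rat_eval (pCons a q) S =
         to_fract (h * h ^ degree q) * rat_const a + (S * to_fract h) * (to_fract (h ^ degree q) * rat_eval q S)"
        using False by (simp add: algebra_simps)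
      also have "\<dots> = to_fract (smult (lead_coeff q) (g ^ Suc (degree q)) + h * (h ^ degree q * [:a:] + g * w))"
        unfolding w Sh rat_const_def to_fract_mult[symmetric] to_fract_add[symmetric]
        by (simp add: algebra_simps)
      finally show ?thesis using False
        by (intro exI[of _ "h ^ degree q * [:a:] + g * w"])
          (simp del: to_fract_add to_fract_mult rat_eval_pCons mult_pCons_right)
    qed
  qed
  obtain w where "to_fract (smult (lead_coeff p) (g ^ degree p) + h * w) = 0"
    using key[of p] assms(2) by auto
  hence "smult (lead_coeff p) (g ^ degree p) + h * w = 0"
    by (simp only: to_fract_eq_0_iff)
  hence "smult (lead_coeff p) (g ^ degree p) = h * (- w)"
    by (simp add: add_eq_0_iff2)
  hence "h dvd smult (lead_coeff p) (g ^ degree p)" by (rule dvdI)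
  hence "h dvd g ^ degree p" using \<open>p \<noteq> 0\<close> by (simp add: dvd_smult_iff)
  moreover have "h dvd g ^ n \<Longrightarrow> is_unit h" for n
    by (induction n) (auto dest: coprime_poly_dvd_mult[OF r(2)])
  ultimately have "is_unit h" by blast
  then obtain k where k: "h = [:k:]" "k \<noteq> 0" using r(1) by (auto simp: is_unit_poly_iff)
  define g' where "g' = smult (inverse k) g"
  have S': "S = to_fract g'" using r(3) k by (simp add: g'_def to_fract_def eq_fract)
  have "pcompose p g' = 0" using assms(2) unfolding S' rat_eval_to_fract by simp
  moreover have "degree g' > 0"
  proof (rule ccontr)
    assume "\<not> degree g' > 0"
    then obtain c where "g' = [:c:]" by (auto elim: degree_eq_zeroE)
    thus False using S S' by (auto simp: rat_const_def)
  qed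
  ultimately show False using \<open>p \<noteq> 0\<close> by (simp add: pcompose_eq_0)
qed

lemma rat_comp_Fract:
  assumes "h \<noteq> 0" "S \<notin> range rat_const"
  shows "rat_comp (Fract g h) S = rat_eval g S / rat_eval h S"
proof -
  obtain a b where r: "rat_repr (Fract g h) = (a, b)" "b \<noteq> 0" "coprime a b" "Fract g h = Fract a b"
    by (rule rat_reprE)
  have "g * b = a * h" using r assms by (simp add: eq_fract)
  hence "rat_eval g S * rat_eval b S = rat_eval a S * rat_eval h S"
    by (metis rat_eval_mult)
  moreover have "rat_eval h S \<noteq> 0" "rat_eval b S \<noteq> 0"
    using rat_eval_eq_0_imp assms r(2) by blast+
  ultimately show ?thesis unfolding rat_comp_def r(1) by (simp add: field_simps)
qed

lemma rat_degree_pos_iff: "rat_degree R > 0 \<longleftrightarrow> R \<notin> range rat_const"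
proof -
  obtain g h where r: "h \<noteq> 0" "coprime g h" "R = Fract g h" by (rule rat_reprE)
  have "R \<in> range rat_const" if "degree g = 0" "degree h = 0"
  proof -
    from that obtain a b where "g = [:a:]" "h = [:b:]" by (auto elim!: degree_eq_zeroE)
    hence "R = rat_const (a / b)" using r by (simp add: rat_const_def to_fract_def eq_fract)
    thus ?thesis by blast
  qed
  moreover have "rat_degree (rat_const c) = 0" for c :: 'a
    unfolding rat_const_def to_fract_def by (subst rat_degree_eq) auto
  moreover have "rat_degree R = max (degree g) (degree h)" using r rat_degree_eq by blast
  ultimately show ?thesis by (cases "rat_degree R = 0") auto
qed

lemma rat_comp_nonconst:
  assumes "R \<notin> range rat_const" "S \<notin> range rat_const"
  shows "rat_comp R S \<notin> range rat_const"
proof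
  assume "rat_comp R S \<in> range rat_const"
  then obtain c where c: "rat_comp R S = rat_const c" by blast
  obtain g h where r: "h \<noteq> 0" "R = Fract g h" by (rule rat_reprE)
  have nz: "rat_eval h S \<noteq> 0" using rat_eval_eq_0_imp assms r by blast
  have "rat_eval g S = rat_const c * rat_eval h S"
    using c nz unfolding r(2) rat_comp_Fract[OF r(1) assms(2)] by (simp add: divide_eq_eq)
  moreover have "rat_const c + rat_const (- c) = 0" by (simp flip: rat_const_simps(3))
  ultimately have "rat_eval (g + smult (-c) h) S = 0"
    unfolding rat_eval_add rat_eval_smult by (simp flip: distrib_right)
  hence "g + smult (-c) h = 0" using rat_eval_eq_0_imp assms by blast
  hence "g = smult c h" by simp
  hence "R = rat_const c" using r by (simp add: rat_const_def to_fract_def eq_fract)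
  thus False using assms by blast
qed

lemma rat_comp_add_mult:
  assumes "T \<notin> range rat_const"
  shows "rat_comp (R + S) T = rat_comp R T + rat_comp S T"
    and "rat_comp (R * S) T = rat_comp R T * rat_comp S T"
    and "rat_comp (R / S) T = rat_comp R T / rat_comp S T"
    and "rat_comp (rat_const c) T = rat_const c"
    and "rat_comp rat_X T = T"
proof -
  obtain a b where r: "b \<noteq> 0" "R = Fract a b" by (rule rat_reprE)
  obtain g h where s: "h \<noteq> 0" "S = Fract g h" by (rule rat_reprE)
  have nz: "rat_eval p T \<noteq> 0" if "p \<noteq> 0" for p using rat_eval_eq_0_imp that assms by blast
  show "rat_comp (R + S) T = rat_comp R T + rat_comp S T"
    "rat_comp (R * S) T = rat_comp R T * rat_comp S T"
    using r s nz[OF r(1)] nz[OF s(1)] by (simp_all add: rat_comp_Fract assms field_simps)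
  show "rat_comp (rat_const c) T = rat_const c"  "rat_comp rat_X T = T"
    unfolding rat_const_def rat_X_def to_fract_def
    by (simp_all add: rat_comp_Fract assms one_pCons) (simp add: rat_const_def to_fract_def one_pCons)
  have z: "rat_comp 0 T = 0"
    using rat_comp_Fract[of 1 T 0] assms by (simp add: fract_collapse)
  show "rat_comp (R / S) T = rat_comp R T / rat_comp S T"
  proof (cases "g = 0")
    case True
    hence "S = 0" using s by (simp add: Zero_fract_def eq_fract)
    thus ?thesis by (simp add: z)
  next
    case False
    thus ?thesis using r s by (simp add: rat_comp_Fract assms)
  qed
qed

lemma rat_comp_rat_eval:
  assumes "T \<notin> range rat_const"
  shows "rat_comp (rat_eval p S) T = rat_eval p (rat_comp S T)"
proof (induction p)
  case 0
  show ?case using rat_comp_add_mult(4)[OF assms, of 0] by simp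
next
  case (pCons a p)
  thus ?case by (simp add: rat_comp_add_mult[OF assms])
qed

lemma rat_comp_assoc:
  assumes "S \<notin> range rat_const" "T \<notin> range rat_const"
  shows "rat_comp (rat_comp R S) T = rat_comp R (rat_comp S T)"
proof -
  obtain g h where r: "h \<noteq> 0" "R = Fract g h" by (rule rat_reprE)
  show ?thesis unfolding r(2)
    by (simp add: rat_comp_Fract r(1) assms rat_comp_nonconst rat_comp_add_mult rat_comp_rat_eval)
qed

lemma rat_comp_X_right: "rat_comp R rat_X = R"
proof -
  obtain g h where r: "rat_repr R = (g, h)" "h \<noteq> 0" "R = Fract g h" by (rule rat_reprE)
  show ?thesis unfolding rat_comp_def r(1) by (simp add: rat_eval_X to_fract_def r)
qed

lemma rat_degree_1_iff:
  "rat_degree A = 1 \<longleftrightarrow> (\<exists>a b c d. a * d - b * c \<noteq> 0 \<and> A = Fract [:b, a:] [:d, c:])"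
proof
  assume A: "rat_degree A = 1"
  obtain g h where r: "h \<noteq> 0" "coprime g h" "A = Fract g h" by (rule rat_reprE)
  have m: "max (degree g) (degree h) = 1" using A rat_degree_eq[OF r(2,1)] r(3) by simp
  define a b c d where "a = coeff g 1" "b = coeff g 0" "c = coeff h 1" "d = coeff h 0"
  have lin: "p = [:coeff p 0, coeff p 1:]" if "degree p \<le> 1" for p :: "'a poly"
    using that by (intro poly_eqI) (auto simp: coeff_pCons coeff_eq_0 split: nat.splits)
  have gh: "g = [:b, a:]" "h = [:d, c:]"
    using lin[of g] lin[of h] m by (auto simp: a_b_c_d_def)
  have "a * d - b * c \<noteq> 0"
  proof
    assume z: "a * d - b * c = 0"
    have ac: "a \<noteq> 0 \<or> c \<noteq> 0" using m gh by auto
    define k where "k = (if a \<noteq> 0 then [:b / a, 1:] else [:d / c, 1:])"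
    have "k dvd g \<and> k dvd h"
    proof (cases "a = 0")
      case True
      hence "b = 0" "c \<noteq> 0" using z ac by auto
      hence "g = 0" "h = smult c k" using True gh by (auto simp: k_def)
      thus ?thesis by (simp add: dvd_smult)
    next
      case False
      hence "g = smult a k" "h = smult c k" using gh z by (auto simp: k_def field_simps)
      thus ?thesis by (simp add: dvd_smult)
    qed
    hence "is_unit k" using r(2) coprime_common_divisor by blast
    moreover have "degree k = 1" "k \<noteq> 0" by (auto simp: k_def)
    ultimately show False by (simp add: is_unit_iff_degree)
  qed
  thus "\<exists>a b c d. a * d - b * c \<noteq> 0 \<and> A = Fract [:b, a:] [:d, c:]" using gh r by blast
next
  assume "\<exists>a b c d. a * d - b * c \<noteq> 0 \<and> A = Fract [:b, a:] [:d, c:]"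
  then obtain a b c d where D: "a * d - b * c \<noteq> 0" and A: "A = Fract [:b, a:] [:d, c:]"
    by (elim exE conjE)
  have "coprime [:b, a:] [:d, c:]"
  proof (rule coprimeI)
    fix k assume "k dvd [:b, a:]" "k dvd [:d, c:]"
    hence "k dvd smult a [:d, c:] - smult c [:b, a:]" by (intro dvd_diff dvd_smult)
    hence k: "k dvd [:a * d - b * c:]" by (simp add: algebra_simps)
    have "is_unit [:a * d - b * c:]" using D by (simp add: is_unit_const_poly_iff dvd_field_iff)
    thus "is_unit k" using k dvd_trans by blast
  qed
  moreover have "[:d, c:] \<noteq> 0" using D by auto
  ultimately have "rat_degree A = max (degree [:b, a:]) (degree [:d, c:])"
    unfolding A by (rule rat_degree_eq)
  thus "rat_degree A = 1" using D by (auto split: if_splits)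
qed

lemma rat_degree_1I: "a * d - b * c \<noteq> 0 \<Longrightarrow> rat_degree (Fract [:b, a:] [:d, c:]) = Suc 0"
  using rat_degree_1_iff[of "Fract [:b, a:] [:d, c:]"] by auto

lemma rat_degree_1E:
  assumes "rat_degree A = Suc 0"
  obtains a b c d where "a * d - b * c \<noteq> 0" "A = Fract [:b, a:] [:d, c:]"
  using assms rat_degree_1_iff[of A] by auto

lemma rat_degree_1_nonconst: "rat_degree A = 1 \<Longrightarrow> A \<notin> range rat_const"
  using rat_degree_pos_iff[of A] by simp

lemma rat_comp_moebius:
  assumes D: "a * d - b * c \<noteq> 0" "a' * d' - b' * c' \<noteq> (0::'a::field)"
  shows "rat_comp (Fract [:b, a:] [:d, c:]) (Fract [:b', a':] [:d', c':]) =
    Fract [:a * b' + b * d', a * a' + b * c':] [:c * b' + d * d', c * a' + d * c':]"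
proof -
  let ?S = "Fract [:b', a':] [:d', c':]"
  have nc: "?S \<notin> range rat_const"
    using D(2) by (intro rat_degree_1_nonconst) (simp add: rat_degree_1I)
  have nz: "[:d, c:] \<noteq> 0" "[:d', c':] \<noteq> 0" using D by auto
  have e: "rat_eval [:q, p:] ?S = Fract [:p * b' + q * d', p * a' + q * c':] [:d', c':]" for p q
    using nz by (simp add: rat_const_def to_fract_def algebra_simps)
  have "rat_eval [:d, c:] ?S \<noteq> 0" using rat_eval_eq_0_imp nc nz by blast
  hence nz': "[:c * b' + d * d', c * a' + d * c':] \<noteq> 0"
    unfolding e using nz by (auto simp: Zero_fract_def eq_fract)
  have quot: "Fract p r / Fract q r = Fract p q" if "q \<noteq> 0" "r \<noteq> 0" for p q r :: "'a poly"
    using that by (simp add: eq_fract)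
  show ?thesis unfolding rat_comp_Fract[OF nz(1) nc] e by (rule quot[OF nz' nz(2)])
qed

lemma group_PGL2: "group (PGL2 :: 'a::field poly fract monoid)"
proof (rule groupI; unfold PGL2_def, simp_all)
  fix A B :: "'a poly fract"
  assume AB: "rat_degree A = Suc 0" "rat_degree B = Suc 0"
  obtain a b c d where A: "a * d - b * c \<noteq> 0" "A = Fract [:b, a:] [:d, c:]"
    using AB(1) by (rule rat_degree_1E)
  obtain a' b' c' d' where B: "a' * d' - b' * c' \<noteq> 0" "B = Fract [:b', a':] [:d', c':]"
    using AB(2) by (rule rat_degree_1E)
  have "(a * a' + b * c') * (c * b' + d * d') - (a * b' + b * d') * (c * a' + d * c')
      = (a * d - b * c) * (a' * d' - b' * c')" by algebra
  hence "(a * a' + b * c') * (c * b' + d * d') - (a * b' + b * d') * (c * a' + d * c') \<noteq> 0"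
    using A B by simp
  thus "rat_degree (rat_comp A B) = Suc 0"
    unfolding A B rat_comp_moebius[OF A(1) B(1)] by (rule rat_degree_1I)
next
  show X: "rat_degree (rat_X :: 'a poly fract) = Suc 0"
    unfolding rat_X_def to_fract_def by (subst rat_degree_eq) auto
  fix A B C :: "'a poly fract"
  assume AB: "rat_degree A = Suc 0" "rat_degree B = Suc 0" "rat_degree C = Suc 0"
  thus "rat_comp (rat_comp A B) C = rat_comp A (rat_comp B C)"
    by (intro rat_comp_assoc rat_degree_1_nonconst) auto
next
  fix A :: "'a poly fract"
  assume A: "rat_degree A = Suc 0"
  thus "rat_comp rat_X A = A"
    by (intro rat_comp_add_mult rat_degree_1_nonconst) auto
  from A obtain a b c d where D: "a * d - b * c \<noteq> 0" and A: "A = Fract [:b, a:] [:d, c:]"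
    by (rule rat_degree_1E)
  have D': "d * a - (- b) * (- c) \<noteq> 0" using D by (simp add: algebra_simps)
  have "rat_degree (Fract [:- b, d:] [:a, - c:]) = Suc 0"
    using D' by (rule rat_degree_1I)
  moreover have "rat_comp (Fract [:- b, d:] [:a, - c:]) A = rat_X"
    unfolding A rat_comp_moebius[OF D' D] rat_X_def to_fract_def using D
    by (simp add: eq_fract algebra_simps)
  ultimately show "\<exists>B. rat_degree B = Suc 0 \<and> rat_comp B A = rat_X" by blast
qed

end

theory Submission
  imports Defs
begin

text \<open>
  The Wronskian of numerator and denominator produces a ramification point; after moving it and its
  value to infinity the denominator is linear or constant. In the constant case \<open>R\<close> becomes a cubic
  polynomial, which affine changes reduce to \<open>x\<^sup>3\<close>, \<open>x\<^sup>3 + x\<^sup>2\<close> or \<open>x\<^sup>3 + x\<close>. In the linear case it becomes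
  \<open>x\<^sup>2 + a x + 1/x\<close>, whose finite ramification points are the roots of \<open>x\<^sup>3 - a x\<^sup>2 + 1\<close>. If \<open>a = 0\<close>, this
  is \<open>(x + 1)\<^sup>3\<close>, so \<open>- 1\<close> is totally ramified and the polynomial case applies again. Otherwise there
  are two distinct roots \<open>p\<close>, \<open>q\<close>; sending \<open>p\<close>, \<open>q\<close> and their values to \<open>0\<close>, \<open>1\<close> gives \<open>R\<^sub>c\<close> with
  \<open>c = p / (p + q)\<close>.
\<close>

section \<open>Arithmetic of constants, degree bounds, explicit degree-one expressions\<close>

lemma rat_const_minus [simp]: "rat_const (- a) = - rat_const a"
  by (metis add.right_inverse add_eq_0_iff rat_const_simps(1,3))

lemma rat_const_diff [simp]: "rat_const (a - b) = rat_const a - rat_const b"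
  using rat_const_simps(3)[of a "- b"] by simp

lemma rat_const_power [simp]: "rat_const (a ^ n) = rat_const a ^ n"
  by (induction n) simp_all

lemma rat_const_divide [simp]: "rat_const (a / b) = rat_const a / rat_const b"
proof (cases "b = 0")
  case False
  hence "rat_const (a / b) * rat_const b = rat_const a"
    by (simp flip: rat_const_simps(4))
  thus ?thesis using False by (simp add: field_simps)
qed simp

lemma rat_const_inj [simp]: "rat_const a = rat_const b \<longleftrightarrow> a = b"
  using rat_const_eq_0_iff[of "a - b"] by simp

text \<open>The reduced pair divides any other representation componentwise, so an explicit quotient
  can be bounded without reducing it first. A zero numerator is treated apart, because divisibility
  into 0 gives no degree bound.\<close>

lemma rat_degree_Fract_le:
  assumes "h \<noteq> 0"
  shows "rat_degree (Fract g h) \<le> max (degree g) (degree h)"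
proof -
  obtain a b where r: "rat_repr (Fract g h) = (a, b)" "b \<noteq> 0" "coprime a b" "Fract g h = Fract a b"
    by (rule rat_reprE)
  have eq: "g * b = a * h" using r assms by (simp add: eq_fract)
  have "b dvd h" using coprime_poly_dvd_mult[OF r(3)] eq by (metis dvd_triv_right)
  moreover have "a dvd g"
    using coprime_poly_dvd_mult[of b a g] r(3) eq by (metis coprime_commute dvd_triv_left mult.commute)
  moreover have "a = 0" if "g = 0" using eq that assms by simp
  ultimately have "degree b \<le> degree h" "degree a \<le> degree g"
    using assms by (auto intro: dvd_imp_degree_le)
  thus ?thesis unfolding rat_degree_def r(1) by auto
qed

lemma rat_degree_X: "rat_degree (rat_X :: 'a::field poly fract) = 1"
  unfolding rat_X_def to_fract_def by (subst rat_degree_eq) auto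

lemma rat_X_nonzero [simp]: "(rat_X :: 'a::field poly fract) \<noteq> 0"
  by (simp add: rat_X_def)

lemma rat_degree_affine:
  assumes "a \<noteq> 0"
  shows "rat_degree (rat_const a * rat_X + rat_const b) = 1"
proof -
  have "rat_const a * rat_X + rat_const b = Fract [:b, a:] [:1, 0:]"
    by (simp add: rat_const_def rat_X_def to_fract_def one_pCons)
  thus ?thesis using rat_degree_1I[of a 1 b 0] assms by simp
qed

lemma rat_degree_inverse_shift: "rat_degree (rat_const b + 1 / rat_X) = 1"
proof -
  have "rat_const b + 1 / rat_X = Fract [:1, b:] [:0, 1:]"
    by (simp add: rat_const_def rat_X_def to_fract_def One_fract_def one_pCons)
  thus ?thesis using rat_degree_1I[of b 0 1 1] by simp
qed

lemma rat_degree_inverse_X: "rat_degree (1 / rat_X) = 1"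
  using rat_degree_inverse_shift[of 0] by simp

section \<open>Composition: homomorphism laws and effect on the degree\<close>

lemma rat_comp_minus:
  assumes "T \<notin> range rat_const"
  shows "rat_comp (- R) T = - rat_comp R T" "rat_comp (R - S) T = rat_comp R T - rat_comp S T"
proof -
  have *: "rat_comp (- R) T = - rat_comp R T" for R
    using rat_comp_add_mult(2)[OF assms, of "rat_const (-1)" R]
      rat_comp_add_mult(4)[OF assms, of "-1"] by simp
  show "rat_comp (- R) T = - rat_comp R T" by (rule *)
  show "rat_comp (R - S) T = rat_comp R T - rat_comp S T"
    using rat_comp_add_mult(1)[OF assms, of R "- S"] * by simp
qed

lemma rat_comp_power:
  assumes "T \<notin> range rat_const"
  shows "rat_comp (R ^ n) T = rat_comp R T ^ n"
  using rat_comp_add_mult(4)[OF assms, of 1]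
  by (induction n) (simp_all add: rat_comp_add_mult[OF assms])

lemma rat_comp_one: "T \<notin> range rat_const \<Longrightarrow> rat_comp 1 T = 1"
  using rat_comp_add_mult(4)[of T 1] by simp

lemmas rat_comp_simps = rat_comp_add_mult rat_comp_minus rat_comp_power

text \<open>The matrix of \<open>B\<close> acts linearly on the pair of numerator and denominator,
  which cannot raise the larger degree. Invertibility upgrades the inequality to an equality in
  \<open>rat_degree_equivalent\<close>.\<close>

lemma rat_degree_comp_left_le:
  assumes "rat_degree B = 1" "S \<notin> range rat_const"
  shows "rat_degree (rat_comp B S) \<le> rat_degree S"
proof -
  obtain a b c d where D: "a * d - b * c \<noteq> 0" and B: "B = Fract [:b, a:] [:d, c:]"
    using assms(1) rat_degree_1_iff by blast
  obtain g h where r: "rat_repr S = (g, h)" "h \<noteq> 0" "S = Fract g h" by (rule rat_reprE)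
  have nz: "[:d, c:] \<noteq> 0" using D by auto
  have e: "rat_eval [:q, p:] S = Fract (smult p g + smult q h) h" for p q
    using r(2) by (simp add: r(3) rat_const_def to_fract_def eq_fract algebra_simps)
  have "rat_eval [:d, c:] S \<noteq> 0" using rat_eval_eq_0_imp assms(2) nz by blast
  hence nz': "smult c g + smult d h \<noteq> 0" unfolding e using r(2) by (auto simp: Zero_fract_def eq_fract)
  have "rat_comp B S = Fract (smult a g + smult b h) (smult c g + smult d h)"
    unfolding B rat_comp_Fract[OF nz assms(2)] e using r(2) nz' by (simp add: eq_fract)
  hence "rat_degree (rat_comp B S) \<le> max (degree (smult a g + smult b h)) (degree (smult c g + smult d h))"
    using rat_degree_Fract_le[OF nz'] by simp
  also have "\<dots> \<le> max (degree g) (degree h)"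
    by (intro max.boundedI degree_add_le) (auto intro: order_trans[OF degree_smult_le])
  finally show ?thesis by (simp add: rat_degree_def r(1))
qed

text \<open>Homogenisation along Horner's scheme. The exponent \<open>n\<close> may exceed
  \<open>degree g\<close>, so that numerator and denominator of one expression can be cleared by the
  same power of \<open>q\<close>.\<close>

lemma rat_eval_Fract_clear:
  assumes "q \<noteq> 0" "degree p \<le> 1" "degree q \<le> 1" "degree g \<le> n"
  shows "\<exists>G. degree G \<le> n \<and> to_fract (q ^ n) * rat_eval g (Fract p q) = to_fract G"
  using assms(4)
proof (induction g arbitrary: n)
  case 0
  show ?case by (intro exI[of _ 0]) simp
next
  case (pCons a g)
  have dq: "degree (q ^ n) \<le> n" for n
    using degree_power_le[of q n] mult_le_mono1[OF assms(3), of n] by linarith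
  show ?case
  proof (cases "g = 0")
    case True
    have "to_fract (q ^ n) * rat_eval (pCons a g) (Fract p q) = to_fract (smult a (q ^ n))"
      by (simp add: True rat_const_def mult.commute flip: to_fract_mult)
    thus ?thesis using dq[of n] order_trans[OF degree_smult_le] by blast
  next
    case False
    \<comment> \<open>One factor \<open>q\<close> is set aside to cancel the denominator of
      \<open>Fract p q\<close>; the remaining \<open>m\<close> factors go into the induction
      hypothesis.\<close>
    with pCons.prems obtain m where m: "n = Suc m" "degree g \<le> m" by (cases n) auto
    obtain G where G: "degree G \<le> m" "to_fract (q ^ m) * rat_eval g (Fract p q) = to_fract G"
      using pCons.IH[OF m(2)] by blast
    have qp: "to_fract q * Fract p q = to_fract p"
      using assms(1) by (simp add: to_fract_def eq_fract)
    have "to_fract (q ^ n) * rat_eval (pCons a g) (Fract p q) =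
        to_fract (q ^ n) * rat_const a + (to_fract q * Fract p q) * (to_fract (q ^ m) * rat_eval g (Fract p q))"
      by (simp add: m(1) algebra_simps)
    also have "\<dots> = to_fract (smult a (q ^ n) + p * G)"
      unfolding qp G(2) by (simp add: rat_const_def mult.commute flip: to_fract_mult)
    finally have *: "to_fract (q ^ n) * rat_eval (pCons a g) (Fract p q) = to_fract (smult a (q ^ n) + p * G)" .
    have "degree (smult a (q ^ n) + p * G) \<le> n"
      using dq[of n] assms(2) G(1) m(1)
      by (intro degree_add_le order_trans[OF degree_smult_le] order_trans[OF degree_mult_le]) auto
    with * show ?thesis by blast
  qed
qed

text \<open>Both parts of \<open>R\<close> are cleared by the denominator of \<open>A\<close> raised
  to \<open>rat_degree R\<close>, and this common factor cancels.\<close>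

lemma rat_degree_comp_right_le:
  assumes A: "rat_degree A = 1"
  shows "rat_degree (rat_comp R A) \<le> rat_degree R"
proof -
  obtain p q where A': "rat_repr A = (p, q)" "q \<noteq> 0" "A = Fract p q" by (rule rat_reprE)
  have pq: "degree p \<le> 1" "degree q \<le> 1" using A by (auto simp: rat_degree_def A'(1))
  obtain g h where r: "rat_repr R = (g, h)" "h \<noteq> 0" "R = Fract g h" by (rule rat_reprE)
  define n where "n = rat_degree R"
  have n: "degree g \<le> n" "degree h \<le> n" by (auto simp: n_def rat_degree_def r(1))
  obtain G where G: "degree G \<le> n" "to_fract (q ^ n) * rat_eval g A = to_fract G"
    using rat_eval_Fract_clear[OF A'(2) pq n(1)] A'(3) by blast
  obtain H where H: "degree H \<le> n" "to_fract (q ^ n) * rat_eval h A = to_fract H"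
    using rat_eval_Fract_clear[OF A'(2) pq n(2)] A'(3) by blast
  have nc: "A \<notin> range rat_const" using A by (rule rat_degree_1_nonconst)
  have q: "to_fract (q ^ n) \<noteq> 0" using A'(2) by simp
  have nz: "rat_eval h A \<noteq> 0" using rat_eval_eq_0_imp nc r(2) by blast
  hence H0: "H \<noteq> 0" using H(2) q by auto
  have "rat_comp R A = rat_eval g A / rat_eval h A"
    unfolding r(3) by (rule rat_comp_Fract[OF r(2) nc])
  also have "\<dots> = (to_fract (q ^ n) * rat_eval g A) / (to_fract (q ^ n) * rat_eval h A)"
    by (rule mult_divide_mult_cancel_left[OF q, symmetric])
  also have "\<dots> = Fract G H" unfolding G(2) H(2) by (simp add: to_fract_def)
  finally have "rat_degree (rat_comp R A) \<le> max (degree G) (degree H)"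
    using rat_degree_Fract_le[OF H0] by simp
  thus ?thesis using G(1) H(1) by (simp add: n_def)
qed

section \<open>The orbit relation on nonconstant expressions\<close>

lemma PGL2_inv:
  assumes "rat_degree A = 1"
  obtains A' where "rat_degree A' = 1" "rat_comp A A' = rat_X" "rat_comp A' A = rat_X"
    "inv\<^bsub>PGL2\<^esub> A = A'" "inv\<^bsub>PGL2\<^esub> A' = A"
proof -
  interpret group "PGL2 :: 'a poly fract monoid" by (rule group_PGL2)
  have A: "A \<in> carrier PGL2" using assms by (simp add: PGL2_def)
  show ?thesis
    using that[of "inv\<^bsub>PGL2\<^esub> A"] A r_inv[OF A] l_inv[OF A] inv_closed[OF A] inv_inv[OF A]
    by (simp add: PGL2_def)
qed

text \<open>Inversion permutes the group, so the inverse in the action can be absorbed into the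
  choice of \<open>A\<close>.\<close>

lemma rat_equivalent_iff:
  "rat_equivalent R S \<longleftrightarrow>
    (\<exists>A B. rat_degree A = 1 \<and> rat_degree B = 1 \<and> S = rat_comp B (rat_comp R A))"
  (is "_ = ?E")
proof
  assume "rat_equivalent R S"
  then obtain A B where "rat_degree A = 1" "rat_degree B = 1" "S = rat_comp B (rat_comp R (inv\<^bsub>PGL2\<^esub> A))"
    by (auto simp: rat_equivalent_def orbit_def PGL2_action_def PGL2_def DirProd_def)
  thus ?E by (metis PGL2_inv)
next
  assume ?E
  then obtain A B where AB: "rat_degree A = 1" "rat_degree B = 1" "S = rat_comp B (rat_comp R A)"
    by blast
  obtain A' where A': "rat_degree A' = 1" "inv\<^bsub>PGL2\<^esub> A' = A"
    using PGL2_inv[OF AB(1)] by metis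
  have "(B, A') \<in> carrier (PGL2 \<times>\<times> PGL2)"
    using AB A' by (simp add: PGL2_def DirProd_def)
  moreover have "PGL2_action (B, A') R = S" using AB A' by (simp add: PGL2_action_def)
  ultimately show "rat_equivalent R S" unfolding rat_equivalent_def orbit_def by blast
qed

lemma rat_equivalent_comp: "rat_degree A = 1 \<Longrightarrow> R \<notin> range rat_const \<Longrightarrow> rat_equivalent R (rat_comp R A)"
  unfolding rat_equivalent_iff
  by (metis rat_comp_add_mult(5) rat_comp_nonconst rat_degree_1_nonconst rat_degree_X)

lemma rat_equivalent_left: "rat_degree B = 1 \<Longrightarrow> rat_equivalent R (rat_comp B R)"
  unfolding rat_equivalent_iff by (metis rat_comp_X_right rat_degree_X)

lemma rat_equivalent_affine:
  assumes "R \<notin> range rat_const" "a \<noteq> 0"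
  shows "rat_equivalent R (rat_const a * R + rat_const b)"
  using rat_equivalent_left[OF rat_degree_affine[OF assms(2), of b], of R]
  by (simp add: rat_comp_simps assms)

lemma rat_equivalent_inverse:
  assumes "R \<notin> range rat_const"
  shows "rat_equivalent R (1 / R)"
  using rat_equivalent_left[OF rat_degree_inverse_X, of R] rat_comp_add_mult(4)[OF assms, of 1]
  by (simp add: rat_comp_simps assms)

lemma PGL2_closed: "rat_degree A = 1 \<Longrightarrow> rat_degree B = 1 \<Longrightarrow> rat_degree (rat_comp A B) = 1"
proof -
  interpret group "PGL2 :: 'a poly fract monoid" by (rule group_PGL2)
  show "rat_degree A = 1 \<Longrightarrow> rat_degree B = 1 \<Longrightarrow> rat_degree (rat_comp A B) = 1"
    using m_closed[of A B] by (simp add: PGL2_def)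
qed

lemma rat_equivalent_refl: "R \<notin> range rat_const \<Longrightarrow> rat_equivalent R R"
  using rat_equivalent_comp[OF rat_degree_X, of R] by (simp add: rat_comp_X_right)

text \<open>Regrouping the composites rests on \<open>rat_comp_assoc\<close>, whose inner arguments
  must be nonconstant; hence the condition on \<open>R\<close>.\<close>

lemma rat_equivalent_trans:
  assumes "rat_equivalent R S" "rat_equivalent S T" "R \<notin> range rat_const"
  shows "rat_equivalent R T"
proof -
  obtain A B where AB: "rat_degree A = 1" "rat_degree B = 1" "S = rat_comp B (rat_comp R A)"
    using assms(1) rat_equivalent_iff by blast
  obtain C D where CD: "rat_degree C = 1" "rat_degree D = 1" "T = rat_comp D (rat_comp S C)"
    using assms(2) rat_equivalent_iff by blast
  note nc = AB(1,2)[THEN rat_degree_1_nonconst] CD(1,2)[THEN rat_degree_1_nonconst]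
  have "T = rat_comp (rat_comp D B) (rat_comp R (rat_comp A C))"
    unfolding CD(3) AB(3) using nc assms(3) by (simp add: rat_comp_assoc rat_comp_nonconst)
  thus ?thesis unfolding rat_equivalent_iff using AB CD PGL2_closed by blast
qed

lemma rat_equivalent_sym:
  assumes "rat_equivalent R S" "R \<notin> range rat_const"
  shows "rat_equivalent S R"
proof -
  obtain A B where AB: "rat_degree A = 1" "rat_degree B = 1" "S = rat_comp B (rat_comp R A)"
    using assms(1) rat_equivalent_iff by blast
  obtain A' where A': "rat_degree A' = 1" "rat_comp A A' = rat_X" using PGL2_inv[OF AB(1)] by metis
  obtain B' where B': "rat_degree B' = 1" "rat_comp B' B = rat_X" using PGL2_inv[OF AB(2)] by metis
  note nc = AB(1,2)[THEN rat_degree_1_nonconst] A'(1)[THEN rat_degree_1_nonconst]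
    B'(1)[THEN rat_degree_1_nonconst]
  have "rat_comp B' (rat_comp S A') = rat_comp (rat_comp B' B) (rat_comp R (rat_comp A A'))"
    unfolding AB(3) using nc assms(2) by (simp add: rat_comp_assoc rat_comp_nonconst)
  also have "\<dots> = R" unfolding A' B' by (simp add: rat_comp_X_right rat_comp_simps assms(2))
  finally show ?thesis unfolding rat_equivalent_iff using A' B' by metis
qed

lemma rat_equivalent_nonconst:
  assumes "rat_equivalent R S" "R \<notin> range rat_const"
  shows "S \<notin> range rat_const"
  using assms unfolding rat_equivalent_iff
  by (metis rat_comp_nonconst rat_degree_1_nonconst)

text \<open>Neither factor of the action raises the degree; symmetry of the relation gives the
  reverse inequality.\<close>

lemma rat_degree_equivalent:
  assumes "rat_equivalent R S" "R \<notin> range rat_const"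
  shows "rat_degree S = rat_degree R"
proof -
  have le: "rat_degree S \<le> rat_degree R" if RS: "rat_equivalent R S" and R: "R \<notin> range rat_const"
    for R S :: "'a poly fract"
  proof -
    obtain A B where AB: "rat_degree A = 1" "rat_degree B = 1" "S = rat_comp B (rat_comp R A)"
      using RS unfolding rat_equivalent_iff by blast
    have "rat_degree S \<le> rat_degree (rat_comp R A)"
      unfolding AB(3)
      by (intro rat_degree_comp_left_le rat_comp_nonconst R rat_degree_1_nonconst[OF AB(1)] AB(2))
    also have "\<dots> \<le> rat_degree R" by (rule rat_degree_comp_right_le[OF AB(1)])
    finally show ?thesis .
  qed
  show ?thesis
    using le[OF assms] le[OF rat_equivalent_sym[OF assms] rat_equivalent_nonconst[OF assms]] by simp
qed

lemma rat_equivalent_affine_compI: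
  assumes "R \<notin> range rat_const" "rat_degree A = 1" "k \<noteq> 0"
    and "S = rat_const k * rat_comp R A + rat_const l"
  shows "rat_equivalent R S"
proof -
  have "rat_comp R A \<notin> range rat_const"
    using assms rat_comp_nonconst rat_degree_1_nonconst by blast
  thus ?thesis
    unfolding assms(4) using assms(1-3)
    by (meson rat_equivalent_affine rat_equivalent_comp rat_equivalent_trans)
qed

section \<open>Ramification points and lowering the degree of the denominator\<close>

lemma rat_degree_nonconst: "0 < rat_degree R \<Longrightarrow> R \<notin> range rat_const"
  using rat_degree_pos_iff by blast

lemma poly_eq_quadratic: "degree p \<le> 2 \<Longrightarrow> p = [:coeff p 0, coeff p 1, coeff p 2:]"
  by (intro poly_eqI) (auto simp: coeff_pCons coeff_eq_0 numeral_2_eq_2 split: nat.splits)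

lemma poly_eq_cubic: "degree p \<le> 3 \<Longrightarrow> p = [:coeff p 0, coeff p 1, coeff p 2, coeff p 3:]"
  by (intro poly_eqI) (auto simp: coeff_pCons coeff_eq_0 numeral_2_eq_2 numeral_3_eq_3 split: nat.splits)

text \<open>Cancelling the common linear factor lowers both degrees. It serves to exclude common
  roots when the degree is known to be \<open>n\<close>.\<close>

lemma rat_degree_common_root_less:
  assumes "h \<noteq> 0" "poly g x = 0" "poly h x = 0" "degree g \<le> n" "degree h \<le> n" "0 < n"
  shows "rat_degree (Fract g h) < n"
proof -
  obtain g' h' where gh: "g = [:- x, 1:] * g'" "h = [:- x, 1:] * h'"
    using assms(2,3) by (auto simp: poly_eq_0_iff_dvd elim!: dvdE)
  have h': "h' \<noteq> 0" using assms(1) gh(2) by auto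
  have "degree g' < n" using assms(4,6) unfolding gh(1)
    by (cases "g' = 0") (simp_all add: degree_mult_eq del: mult_pCons_left)
  moreover have "degree h' < n" using assms(5) h' unfolding gh(2)
    by (simp add: degree_mult_eq del: mult_pCons_left)
  moreover have "Fract g h = Fract g' h'"
    using h' assms(1) unfolding gh by (simp add: eq_fract del: mult_pCons_left)
  ultimately show ?thesis using rat_degree_Fract_le[OF h', of g'] by simp
qed

text \<open>The value at infinity is moved to infinity. If it is a finite \<open>t\<close>,
  subtracting \<open>t\<close> kills the coefficient of degree \<open>n\<close> in the numerator,
  and inversion turns that numerator into the denominator.\<close>

lemma rat_equivalent_lower_denominator:
  assumes n: "rat_degree R = n" "0 < n"
  obtains g h where "h \<noteq> 0" "degree g \<le> n" "degree h < n" "rat_equivalent R (Fract g h)"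
proof -
  have R: "R \<notin> range rat_const" using n rat_degree_nonconst by blast
  obtain a b where r: "rat_repr R = (a, b)" "b \<noteq> 0" "R = Fract a b" by (rule rat_reprE)
  have d: "degree a \<le> n" "degree b \<le> n" using n by (auto simp: rat_degree_def r(1))
  show ?thesis
  proof (cases "degree b < n")
    case True
    thus ?thesis using that[of b a] d r R rat_equivalent_refl by blast
  next
    case False
    define t where "t = coeff a n / coeff b n"
    define b' where "b' = a - smult t b"
    have bn: "coeff b n \<noteq> 0" using False d r(2) by (metis leading_coeff_0_iff nat_less_le)
    have b': "rat_const 1 * R + rat_const (- t) = Fract b' b"
      using r(2) unfolding r(3) b'_def by (simp add: rat_const_def to_fract_def)
    have R': "rat_equivalent R (Fract b' b)"
      unfolding b'[symmetric] by (rule rat_equivalent_affine[OF R]) simp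
    have nc: "Fract b' b \<notin> range rat_const" by (rule rat_equivalent_nonconst[OF R' R])
    have nz: "b' \<noteq> 0"
      using nc rat_const_simps(1)[where ?'a = 'a] by (auto simp: fract_collapse simp del: rat_const_simps)
    have "degree b' \<le> n" unfolding b'_def
      using d by (intro degree_diff_le) (auto intro: order_trans[OF degree_smult_le])
    moreover have "coeff b' n = 0" using bn by (simp add: b'_def t_def)
    ultimately have "degree b' < n" using nz by (metis leading_coeff_0_iff nat_less_le)
    moreover have "rat_equivalent R (Fract b b')"
      using rat_equivalent_trans[OF R' rat_equivalent_inverse[OF nc] R] by (simp add: One_fract_def)
    ultimately show ?thesis using that nz d by blast
  qed
qed

lemma double_root_dvd:
  fixes f :: "'a::field poly"
  assumes "poly f x = 0" "poly (pderiv f) x = 0"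
  obtains l where "f = [:- x, 1:] * ([:- x, 1:] * l)"
proof -
  obtain f1 where f1: "f = [:- x, 1:] * f1" using assms(1) by (auto simp: poly_eq_0_iff_dvd elim!: dvdE)
  have "poly f1 x = 0" using assms(2) unfolding f1 by (simp add: pderiv_mult pderiv_pCons del: mult_pCons_left)
  then obtain l where "f1 = [:- x, 1:] * l" by (auto simp: poly_eq_0_iff_dvd elim!: dvdE)
  thus ?thesis using that f1 by blast
qed

text \<open>At a zero \<open>x\<close> of the Wronskian where \<open>h\<close> does not vanish, the
  value \<open>t\<close> is taken at least twice. Inversion after subtracting \<open>t\<close> makes
  \<open>x\<close> a multiple pole; moving it to infinity leaves at most one finite pole.\<close>

lemma rat_equivalent_ramified:
  fixes x :: "'a::field"
  assumes S: "Fract g h \<notin> range rat_const" "h \<noteq> 0" "degree g \<le> 3" "degree h \<le> 3"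
    and x: "poly h x \<noteq> 0" "poly (pderiv g * h - g * pderiv h) x = 0"
  obtains G H where "H \<noteq> 0" "degree G \<le> 3" "degree H \<le> 1" "rat_equivalent (Fract g h) (Fract G H)"
proof -
  define t where "t = poly g x / poly h x"
  define f where "f = g - smult t h"
  have "poly f x = 0" using x by (simp add: f_def t_def)
  \<comment> \<open>Dividing the vanishing Wronskian by \<open>h(x)\<close> gives
    \<open>g'(x) = t h'(x)\<close>.\<close>
  moreover have "poly (pderiv f) x = 0"
    using x by (simp add: f_def t_def pderiv_diff pderiv_smult field_simps)
  ultimately obtain l where l: "f = [:- x, 1:] * ([:- x, 1:] * l)" by (rule double_root_dvd)
  have f: "rat_const 1 * Fract g h + rat_const (- t) = Fract f h"
    using S(2) unfolding f_def by (simp add: rat_const_def to_fract_def)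
  have eq1: "rat_equivalent (Fract g h) (Fract f h)"
    unfolding f[symmetric] by (rule rat_equivalent_affine[OF S(1)]) simp
  have nc: "Fract f h \<notin> range rat_const" by (rule rat_equivalent_nonconst[OF eq1 S(1)])
  have f0: "f \<noteq> 0"
    using nc rat_const_simps(1)[where ?'a = 'a] by (auto simp: fract_collapse simp del: rat_const_simps)
  have eq2: "rat_equivalent (Fract g h) (Fract h f)"
    using rat_equivalent_trans[OF eq1 rat_equivalent_inverse[OF nc] S(1)] by (simp add: One_fract_def)
  have "degree f \<le> 3" unfolding f_def
    using S by (intro degree_diff_le) (auto intro: order_trans[OF degree_smult_le])
  moreover have l0: "l \<noteq> 0" using f0 l by auto
  ultimately have dl: "degree l \<le> 1" unfolding l by (simp add: degree_mult_eq del: mult_pCons_left)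
  \<comment> \<open>The expression \<open>x + 1/X\<close> sends infinity to the point
    \<open>x\<close>.\<close>
  define A where "A = Fract [:1, x:] [:0, 1:]"
  have A: "A = rat_const x + 1 / rat_X"
    by (simp add: A_def rat_const_def rat_X_def to_fract_def One_fract_def one_pCons)
  have dA: "rat_degree A = 1" unfolding A by (rule rat_degree_inverse_shift)
  have ncA: "A \<notin> range rat_const" using dA by (rule rat_degree_1_nonconst)
  have X: "to_fract [:0, 1 :: 'a:] = rat_X" by (simp add: rat_X_def)
  have d1: "[:0, 1:] \<noteq> (0::'a poly)" "degree [:1, x:] \<le> 1" "degree [:0, 1 :: 'a:] \<le> 1"
    by (simp_all add: degree_pCons_eq_if)
  have X3: "to_fract ([:0, 1 :: 'a:] ^ 3) = rat_X ^ 3"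
    by (simp add: rat_X_def power3_eq_cube flip: to_fract_mult)
  obtain H where H: "degree H \<le> 3" "rat_X ^ 3 * rat_eval h A = to_fract H"
    using rat_eval_Fract_clear[OF d1 S(4)] X3 by (auto simp: A_def)
  obtain L where L: "degree L \<le> 1" "rat_X * rat_eval l A = to_fract L"
    using rat_eval_Fract_clear[OF d1 dl] X by (auto simp: A_def)
  have nz: "rat_eval l A \<noteq> 0" using rat_eval_eq_0_imp ncA l0 by blast
  hence L0: "L \<noteq> 0" using L by auto
  \<comment> \<open>Each of the two factors of the double root contributes \<open>1/X\<close>, so
    clearing \<open>f(A)\<close> by the cube of \<open>X\<close> leaves \<open>X\<close> times
    \<open>l(A)\<close>, which is a polynomial of degree at most one.\<close>
  have "rat_eval [:- x, 1:] A = 1 / rat_X" by (simp add: A)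
  hence fA: "rat_eval f A = rat_eval l A / rat_X ^ 2"
    unfolding l by (simp add: power2_eq_square del: rat_eval_pCons mult_pCons_left)
  have "rat_comp (Fract h f) A = (rat_X ^ 3 * rat_eval h A) / (rat_X * rat_eval l A)"
    unfolding rat_comp_Fract[OF f0 ncA] fA
    using nz by (simp add: field_simps power2_eq_square power3_eq_cube)
  also have "\<dots> = Fract H L" unfolding H L by (simp add: to_fract_def)
  finally have "rat_equivalent (Fract h f) (Fract H L)"
    using rat_equivalent_comp[OF dA rat_equivalent_nonconst[OF eq2 S(1)]] by simp
  thus ?thesis using that[OF L0 H(1) L(1)] rat_equivalent_trans[OF eq2 _ S(1)] by blast
qed

text \<open>Once the denominator has degree below three, only a quadratic one needs work. There the
  Wronskian is nonconstant, so its root provides a finite ramification point.\<close>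

lemma rat_equivalent_linear_denominator:
  fixes R :: "'a::alg_closed_field poly fract"
  assumes "rat_degree R = 3"
  obtains g h where "h \<noteq> 0" "degree g \<le> 3" "degree h \<le> 1" "rat_equivalent R (Fract g h)"
proof -
  have R: "R \<notin> range rat_const" using assms rat_degree_nonconst[of R] by simp
  obtain g h where gh: "h \<noteq> 0" "degree g \<le> 3" "degree h < 3" "rat_equivalent R (Fract g h)"
    using rat_equivalent_lower_denominator[OF assms zero_less_numeral] .
  have nc: "Fract g h \<notin> range rat_const" by (rule rat_equivalent_nonconst[OF gh(4) R])
  have deg: "rat_degree (Fract g h) = 3" using rat_degree_equivalent[OF gh(4) R] assms by simp
  show ?thesis
  proof (cases "degree h \<le> 1")
    case True
    thus ?thesis using that gh by blast
  next
    case False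
    hence h2: "degree h = 2" using gh(3) by simp
    have g3: "degree g = 3" using rat_degree_Fract_le[OF gh(1), of g] deg h2 gh(2) by simp
    define W where "W = pderiv g * h - g * pderiv h"
    \<comment> \<open>The coefficient is \<open>(3 - 2) g\<^sub>3 h\<^sub>2\<close>.\<close>
    have "coeff W 4 = coeff g 3 * coeff h 2"
      unfolding W_def
      by (subst (1 2) poly_eq_cubic[OF gh(2)], subst (1 2) poly_eq_quadratic[of h])
        (simp_all add: h2 pderiv_pCons coeff_pCons eval_nat_numeral algebra_simps)
    moreover have "coeff g 3 \<noteq> 0" "coeff h 2 \<noteq> 0" using g3 h2 by (metis leading_coeff_0_iff degree_0 zero_neq_numeral)+
    ultimately have "coeff W 4 \<noteq> 0" by simp
    hence "degree W \<ge> 4" by (rule le_degree)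
    then obtain x where x: "poly W x = 0" using alg_closed_imp_poly_has_root[of W] by auto
    have "\<exists>G H. H \<noteq> 0 \<and> degree G \<le> 3 \<and> degree H \<le> 1 \<and> rat_equivalent (Fract g h) (Fract G H)"
    proof (cases "poly h x = 0")
      case False
      show ?thesis
        by (rule rat_equivalent_ramified[OF nc gh(1,2) _ False]) (use gh(3) x in \<open>auto simp: W_def\<close>)
    next
      \<comment> \<open>At a pole, numerator and denominator are swapped, which only changes the
        sign of the Wronskian. A common root of both would push the degree below three.\<close>
      case True
      have gx: "poly g x \<noteq> 0"
        using rat_degree_common_root_less[OF gh(1) _ True gh(2)] deg gh(3) by auto
      hence g0: "g \<noteq> 0" by auto
      have eq: "rat_equivalent (Fract g h) (Fract h g)"
        using rat_equivalent_inverse[OF nc] by (simp add: One_fract_def)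
      obtain G H where "H \<noteq> 0" "degree G \<le> 3" "degree H \<le> 1" "rat_equivalent (Fract h g) (Fract G H)"
        by (rule rat_equivalent_ramified[OF rat_equivalent_nonconst[OF eq nc] g0 _ gh(2) gx])
          (use gh(3) x in \<open>auto simp: W_def algebra_simps\<close>)
      thus ?thesis using rat_equivalent_trans[OF eq _ nc] by blast
    qed
    thus ?thesis using that rat_equivalent_trans[OF gh(4) _ R] by blast
  qed
qed

section \<open>Normal forms, and cubic polynomials in characteristic three\<close>

definition has_normal_form :: "'a::field poly fract \<Rightarrow> bool"
  where "has_normal_form R \<longleftrightarrow>
    rat_equivalent R (rat_X ^ 3) \<or>
    rat_equivalent R (rat_X ^ 3 + rat_X ^ 2) \<or>
    rat_equivalent R (rat_X ^ 3 + rat_X) \<or>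
    (\<exists>c. c \<notin> range of_int \<and> rat_equivalent R (R_c c))"

lemma has_normal_form_equivalent:
  "rat_equivalent R S \<Longrightarrow> has_normal_form S \<Longrightarrow> R \<notin> range rat_const \<Longrightarrow> has_normal_form R"
  unfolding has_normal_form_def using rat_equivalent_trans by blast

text \<open>The method \<open>algebra\<close> cannot exploit \<open>3 = 0\<close> as a premise, so identities below are
  proved with an explicit multiple of \<open>3\<close> as error term, which this lemma then removes.\<close>

lemma three_fract: "(3::'a::field) = 0 \<Longrightarrow> (3::'a poly fract) = 0"
proof -
  assume "(3::'a) = 0"
  moreover have "(3::'a) = 1 + 1 + 1" "(3::'a poly fract) = 1 + 1 + 1" by simp_all
  moreover have "rat_const (1 + 1 + 1 :: 'a) = 1 + 1 + 1" by (simp only: rat_const_simps)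
  ultimately show ?thesis by (metis rat_const_simps(1))
qed

lemma has_normal_form_monic_cubic:
  fixes a b :: "'a::alg_closed_field"
  assumes three: "(3::'a) = 0" and nc: "S \<notin> range rat_const"
    and S: "S = rat_X ^ 3 + rat_const a * rat_X ^ 2 + rat_const b * rat_X"
  shows "has_normal_form S"
proof (cases "a = 0")
  case True
  show ?thesis
  proof (cases "b = 0")
    case True
    thus ?thesis using \<open>a = 0\<close> rat_equivalent_refl[OF nc] by (simp add: has_normal_form_def S)
  next
    case False
    \<comment> \<open>Replacing \<open>X\<close> by \<open>t X\<close> gives the cubic and the
      linear term the same coefficient \<open>t ^ 3\<close>.\<close>
    obtain t where t: "t ^ 2 = b" using nth_root_exists[of 2 b] by auto
    hence t0: "t \<noteq> 0" using False by auto
    let ?A = "rat_const t * rat_X + rat_const 0"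
    have dA: "rat_degree ?A = 1" using t0 by (rule rat_degree_affine)
    have "rat_X ^ 3 + rat_X = rat_const (1 / t ^ 3) * rat_comp S ?A + rat_const 0"
      using t0 rat_degree_1_nonconst[OF dA] unfolding S t[symmetric]
      by (simp add: rat_comp_simps \<open>a = 0\<close> field_simps power2_eq_square power3_eq_cube)
    hence "rat_equivalent S (rat_X ^ 3 + rat_X)"
      by (rule rat_equivalent_affine_compI[OF nc dA, rotated]) (use t0 in simp)
    thus ?thesis by (simp add: has_normal_form_def)
  qed
next
  case False
  \<comment> \<open>The derivative \<open>2 a x + b\<close> vanishes at \<open>s\<close>, since
    \<open>2 = -1\<close>. Shifting by \<open>s\<close> removes the linear term and, cubing being
    additive, creates no new quadratic one. Scaling by \<open>a\<close> then gives both remaining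
    terms the coefficient \<open>a ^ 3\<close>.\<close>
  define s where "s = b / a"
  have b: "b = s * a" using False by (simp add: s_def)
  let ?A = "rat_const a * rat_X + rat_const s" and ?l = "- (s ^ 3 + a * s ^ 2 + b * s) / a ^ 3"
  have dA: "rat_degree ?A = 1" using False by (rule rat_degree_affine)
  have "rat_X ^ 3 + rat_X ^ 2 = rat_const (1 / a ^ 3) * rat_comp S ?A + rat_const ?l"
  proof -
    have "rat_comp S ?A = ?A ^ 3 + rat_const a * ?A ^ 2 + rat_const b * ?A"
      using rat_degree_1_nonconst[OF dA] unfolding S by (simp add: rat_comp_simps)
    also have "\<dots> = rat_const (a ^ 3) * (rat_X ^ 3 + rat_X ^ 2) + rat_const (s ^ 3 + a * s ^ 2 + b * s)
        + 3 * (rat_const (a ^ 2 * s) * rat_X ^ 2 + rat_const (a * s ^ 2 + a ^ 2 * s) * rat_X)"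
      unfolding b rat_const_simps rat_const_power by algebra
    finally have "rat_comp S ?A =
        rat_const (a ^ 3) * (rat_X ^ 3 + rat_X ^ 2) + rat_const (s ^ 3 + a * s ^ 2 + b * s)"
      by (simp only: three_fract[OF three] mult_zero_left add_0_right)
    thus ?thesis using False by (simp add: field_simps)
  qed
  hence "rat_equivalent S (rat_X ^ 3 + rat_X ^ 2)"
    by (rule rat_equivalent_affine_compI[OF nc dA, rotated]) (use False in simp)
  thus ?thesis by (simp add: has_normal_form_def)
qed

lemma has_normal_form_cubic:
  fixes k3 k2 k1 k0 :: "'a::alg_closed_field"
  assumes three: "(3::'a) = 0" and nc: "S \<notin> range rat_const" and k3: "k3 \<noteq> 0"
    and S: "S = rat_const k3 * rat_X ^ 3 + rat_const k2 * rat_X ^ 2 + rat_const k1 * rat_X + rat_const k0"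
  shows "has_normal_form S"
proof -
  define T where "T = rat_const (1 / k3) * S + rat_const (- k0 / k3)"
  have eq: "rat_equivalent S T" unfolding T_def by (rule rat_equivalent_affine[OF nc]) (use k3 in simp)
  have "T = rat_X ^ 3 + rat_const (k2 / k3) * rat_X ^ 2 + rat_const (k1 / k3) * rat_X"
    using k3 by (simp add: T_def S field_simps)
  thus ?thesis
    using has_normal_form_monic_cubic[OF three rat_equivalent_nonconst[OF eq nc]]
      has_normal_form_equivalent[OF eq _ nc] by blast
qed

section \<open>The family \<open>R_c\<close> and expressions with one simple finite pole\<close>

lemma of_int_char_3:
  assumes "(3::'a::field) = 0" "c \<in> range (of_int :: int \<Rightarrow> 'a)"
  shows "c \<in> {0, 1, - 1}"
proof -
  obtain n where n: "c = of_int n" using assms(2) by blast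
  have "c = of_int (3 * (n div 3) + n mod 3)" unfolding n by simp
  also have "\<dots> = of_int (n mod 3)" by (simp only: of_int_add of_int_mult) (simp add: assms(1))
  finally have c: "c = of_int (n mod 3)" .
  have "(2::'a) = 3 - 1" by simp
  hence two: "(2::'a) = - 1" using assms(1) by simp
  have "n mod 3 = 0 \<or> n mod 3 = 1 \<or> n mod 3 = 2" by arith
  thus ?thesis unfolding c by (auto simp: two)
qed

text \<open>The last two equations are Vieta's relations for roots \<open>p\<close>,
  \<open>q\<close> of \<open>x^3 - a x^2 + 1\<close>, with the third root
  \<open>- p q / (p + q)\<close> eliminated. The target fixes 0, 1 and infinity and is ramified
  there and at \<open>c\<close>; the map \<open>?A\<close> sends 0, 1 and \<open>c\<close> to
  \<open>p\<close>, \<open>q\<close> and the third root.\<close>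

lemma R_c_equivalent:
  fixes a p q :: "'a::field"
  assumes three: "(3::'a) = 0" and nc: "S \<notin> range rat_const"
    and S: "S = rat_X ^ 2 + rat_const a * rat_X + 1 / rat_X"
    and pq: "p \<noteq> 0" "q \<noteq> 0" "p \<noteq> q" "p + q = p ^ 2 * q ^ 2" "(p - q) ^ 2 = a * (p + q)"
  shows "rat_equivalent S (R_c (p / (p + q)))"
proof -
  define c where "c = p / (p + q)"
  let ?A = "rat_const (q - p) * rat_X + rat_const p"
  \<comment> \<open>These are forced by sending \<open>S(p)\<close> to 0 and \<open>S(q)\<close> to
    1, because \<open>S(q) - S(p) = - (q - p)^3 / (p + q)\<close>.\<close>
  define k l where "k = - (p + q) / (q - p) ^ 3" and "l = - k * (p ^ 2 + a * p + 1 / p)"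
  have dA: "rat_degree ?A = 1" using pq by (intro rat_degree_affine) simp
  have s0: "p + q \<noteq> 0" using pq by simp
  have A0: "?A \<noteq> 0" using rat_degree_1_nonconst[OF dA] rat_const_simps(1) by (metis rangeI)
  have SA: "rat_comp S ?A = ?A ^ 2 + rat_const a * ?A + 1 / ?A"
    using rat_degree_1_nonconst[OF dA] unfolding S by (simp add: rat_comp_simps rat_comp_one)
  \<comment> \<open>This is \<open>S(p)\<close>. Multiplication by \<open>p + q\<close> makes it
    polynomial in \<open>p\<close> and \<open>q\<close>: the relations remove both \<open>a\<close>
    and \<open>1 / p\<close>.\<close>
  define m where "m = p ^ 2 + a * p + 1 / p"
  have "(p + q) * m = (p + q) * p ^ 2 + a * (p + q) * p + p ^ 2 * q ^ 2 / p"
    unfolding pq(4)[symmetric] by (simp add: m_def algebra_simps)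
  also have "\<dots> = (p + q) * p ^ 2 + (p - q) ^ 2 * p + p * q ^ 2"
    using pq(1) unfolding pq(5)[symmetric] by (simp add: power2_eq_square)
  finally have "rat_const ((p + q) * m) = rat_const ((p + q) * p ^ 2 + (p - q) ^ 2 * p + p * q ^ 2)"
    by simp
  moreover have "rat_const (p + q) = rat_const (p ^ 2 * q ^ 2)" using pq(4) by simp
  moreover have "rat_const ((p - q) ^ 2) = rat_const (a * (p + q))" using pq(5) by simp
  \<comment> \<open>The left side is \<open>(p + q) A (S(A) - S(p))\<close>. Modulo 3 it shows the
    double zero at 0 expected from ramification at \<open>p\<close>.\<close>
  ultimately have "rat_const (p + q) * (?A ^ 3 + 1) + rat_const (p + q) * rat_const a * ?A ^ 2
        - rat_const (p + q) * rat_const m * ?A =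
      rat_const (q - p) ^ 3 * (rat_X ^ 2 * (rat_const (p + q) * rat_X + rat_const (q - p)))
        + 3 * (rat_const ((p + q) * (q - p) ^ 2 * p) * rat_X ^ 2 + rat_const ((q - p) * p ^ 3) * rat_X)"
    unfolding rat_const_simps rat_const_power rat_const_diff by algebra
  hence "rat_const (p + q) * (?A ^ 3 + 1) + rat_const (p + q) * rat_const a * ?A ^ 2
        - rat_const (p + q) * rat_const m * ?A =
      rat_const (q - p) ^ 3 * (rat_X ^ 2 * (rat_const (p + q) * rat_X + rat_const (q - p)))"
    by (simp only: three_fract[OF three] mult_zero_left add_0_right)
  \<comment> \<open>Solves the cleared identity for \<open>N / A\<close> over arbitrary field
    elements, so that the concrete constants stay unexpanded.\<close>
  moreover have "- (N / A) = - (s / d ^ 3) * (A ^ 2 + b * A + 1 / A) + s / d ^ 3 * m"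
    if "s * (A ^ 3 + 1) + s * b * A ^ 2 - s * m * A = d ^ 3 * N" "A \<noteq> 0" "d \<noteq> 0"
    for N A s d b m :: "'a poly fract"
  proof -
    have "N = (s * (A ^ 3 + 1) + s * b * A ^ 2 - s * m * A) / d ^ 3" using that by simp
    thus ?thesis using that(2,3) by (simp add: field_simps power2_eq_square power3_eq_cube)
  qed
  ultimately have "- (rat_X ^ 2 * (rat_const (p + q) * rat_X + rat_const (q - p)) / ?A) =
      - (rat_const (p + q) / rat_const (q - p) ^ 3) * (?A ^ 2 + rat_const a * ?A + 1 / ?A)
      + rat_const (p + q) / rat_const (q - p) ^ 3 * rat_const m"
    using A0 pq(3) by simp
  also have "\<dots> = rat_const k * rat_comp S ?A + rat_const l"
  proof -
    have k: "rat_const k = - (rat_const (p + q) / rat_const (q - p) ^ 3)"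
      by (simp only: k_def rat_const_divide rat_const_minus rat_const_power minus_divide_left)
    have l: "rat_const l = - rat_const k * rat_const m"
      by (simp only: l_def m_def rat_const_simps(4) rat_const_minus)
    show ?thesis unfolding SA l k by (simp only: minus_minus)
  qed
  also have "- (rat_X ^ 2 * (rat_const (p + q) * rat_X + rat_const (q - p)) / ?A) = R_c c"
  proof -
    have "c + 1 = (q - p + 3 * p) / (p + q)" using s0 by (simp add: c_def field_simps)
    hence c1: "c + 1 = (q - p) / (p + q)" unfolding three by simp
    have num: "rat_X ^ 3 + rat_const (c + 1) * rat_X ^ 2 =
        rat_X ^ 2 * (rat_const (p + q) * rat_X + rat_const (q - p)) / rat_const (p + q)"
      using s0 unfolding c1 rat_const_divide
      by (simp add: field_simps power2_eq_square power3_eq_cube flip: rat_const_simps(3))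
    have den: "- rat_const (c + 1) * rat_X - rat_const c = - ?A / rat_const (p + q)"
      unfolding c1 unfolding c_def rat_const_divide
      by (simp add: diff_divide_distrib del: rat_const_simps(3) rat_const_diff)
    show ?thesis using s0 A0 unfolding R_c_def num den
      by (simp del: rat_const_simps(3) rat_const_diff minus_add_distrib)
  qed
  finally have "R_c c = rat_const k * rat_comp S ?A + rat_const l" .
  thus ?thesis unfolding c_def
    by (rule rat_equivalent_affine_compI[OF nc dA, rotated]) (use s0 pq in \<open>simp add: k_def\<close>)
qed

lemma has_normal_form_quadratic_plus_pole:
  fixes a :: "'a::alg_closed_field"
  assumes three: "(3::'a) = 0" and nc: "S \<notin> range rat_const"
    and S: "S = rat_X ^ 2 + rat_const a * rat_X + 1 / rat_X"
  shows "has_normal_form S"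
proof (cases "a = 0")
  case True
  \<comment> \<open>This sends infinity to -1, the triple zero of \<open>(x + 1)^3 / x\<close>.
    After inversion infinity is a triple pole, leaving a polynomial.\<close>
  let ?A = "rat_const (- 1 :: 'a) + 1 / rat_X"
  have dA: "rat_degree ?A = 1" by (rule rat_degree_inverse_shift)
  note ncA = rat_degree_1_nonconst[OF dA]
  have A0: "?A \<noteq> 0" using ncA rat_const_simps(1) by (metis rangeI)
  have eq: "rat_equivalent S (rat_comp S ?A)" by (rule rat_equivalent_comp[OF dA nc])
  have nc': "rat_comp S ?A \<notin> range rat_const" by (rule rat_equivalent_nonconst[OF eq nc])
  have eq': "rat_equivalent S (1 / rat_comp S ?A)"
    by (rule rat_equivalent_trans[OF eq rat_equivalent_inverse[OF nc'] nc])
  have "rat_comp S ?A = ?A ^ 2 + 1 / ?A"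
    unfolding S True
    by (simp add: rat_comp_simps[OF ncA] rat_comp_one[OF ncA] del: rat_const_minus rat_const_simps(2))
  also have "\<dots> = (?A ^ 3 + 1) / ?A"
    using A0 by (simp add: add_divide_distrib power2_eq_square power3_eq_cube)
  also have "?A ^ 3 + 1 = (?A + 1) ^ 3 - 3 * (?A ^ 2 + ?A)" by algebra
  also have "\<dots> = (?A + 1) ^ 3" by (simp only: three_fract[OF three] mult_zero_left diff_zero)
  also have "?A + 1 = 1 / rat_X" by simp
  finally have SA: "rat_comp S ?A = (1 / rat_X) ^ 3 / ?A" .
  have "1 / rat_comp S ?A = ?A * rat_X ^ 3" unfolding SA by (simp add: power_divide)
  also have "\<dots> = rat_const (- 1) * rat_X ^ 3 + rat_const 1 * rat_X ^ 2 + rat_const 0 * rat_X + rat_const 0"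
    by (simp add: algebra_simps power2_eq_square power3_eq_cube)
  finally have "has_normal_form (1 / rat_comp S ?A)"
    by (rule has_normal_form_cubic[OF three rat_equivalent_nonconst[OF eq' nc], rotated]) simp
  thus ?thesis by (rule has_normal_form_equivalent[OF eq' _ nc])
next
  case False
  obtain p where p: "poly [:1, 0, - a, 1:] p = 0"
    using alg_closed_imp_poly_has_root[of "[:1, 0, - a, 1:]"] by auto
  \<comment> \<open>The quadratic is the quotient of \<open>x^3 - a x^2 + 1\<close> by
    \<open>x - p\<close>.\<close>
  obtain q where q: "poly [:p * (p - a), p - a, 1:] q = 0"
    using alg_closed_imp_poly_has_root[of "[:p * (p - a), p - a, 1:]"] by auto
  have p1: "p ^ 3 - a * p ^ 2 + 1 = 0" using p by (simp add: algebra_simps power2_eq_square power3_eq_cube)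
  have q1: "q ^ 2 + (p - a) * q + p * (p - a) = 0" using q by (simp add: algebra_simps power2_eq_square)
  have q2: "q ^ 3 - a * q ^ 2 + 1 = 0" using p1 q1 by algebra
  have pq0: "p \<noteq> 0" "q \<noteq> 0" using p1 q2 by auto
  have "(p - q) ^ 2 = a * (p + q) - 3 * (p * q)" using q1 by algebra
  hence sq: "(p - q) ^ 2 = a * (p + q)" by (simp only: three mult_zero_left diff_zero)
  have pq: "p \<noteq> q"
  proof
    assume "p = q"
    \<comment> \<open>With \<open>q = p\<close> the quadratic relation reads
      \<open>3 p^2 - 2 a p = 0\<close>.\<close>
    have "a * p = 3 * (a * p - p ^ 2)" using q1 unfolding \<open>p = q\<close> by algebra
    hence "a * p = 0" by (simp only: three mult_zero_left)
    thus False using False pq0 by simp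
  qed
  have s: "p + q = p ^ 2 * q ^ 2" using p1 q1 by algebra
  have s0: "p + q \<noteq> 0" using s pq0 by simp
  \<comment> \<open>The quotient is 0 only if \<open>p = 0\<close>, 1 only if \<open>q = 0\<close>,
    and -1 only if \<open>2 p + q = 0\<close>, that is \<open>p = q\<close> in characteristic three.
    These values exhaust the prime field \<open>range of_int\<close>.\<close>
  have "p / (p + q) \<noteq> 0" "p / (p + q) \<noteq> 1" using pq0 s0 by (simp_all add: field_simps)
  moreover have "p / (p + q) \<noteq> - 1"
  proof
    assume "p / (p + q) = - 1"
    hence "p = - (p + q)" using s0 by (simp add: field_simps)
    hence "p = q + 3 * p" by algebra
    hence "p = q" by (simp only: three mult_zero_left add_0_right)
    thus False using pq by simp
  qed
  ultimately have "p / (p + q) \<notin> range of_int" using of_int_char_3[OF three] by blast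
  thus ?thesis
    using R_c_equivalent[OF three nc S pq0 pq s sq] unfolding has_normal_form_def by blast
qed

section \<open>Reduction of constant and linear denominators to the cases above\<close>

lemma has_normal_form_linear_denominator:
  fixes S :: "'a::alg_closed_field poly fract"
  assumes three: "(3::'a) = 0" and deg: "rat_degree S = 3"
    and S: "S = Fract g h" "h \<noteq> 0" "degree g \<le> 3" "degree h \<le> 1"
  shows "has_normal_form S"
proof -
  have nc: "S \<notin> range rat_const" using deg rat_degree_nonconst[of S] by simp
  have eval: "to_fract f = rat_const (coeff f 3) * rat_X ^ 3 + rat_const (coeff f 2) * rat_X ^ 2
      + rat_const (coeff f 1) * rat_X + rat_const (coeff f 0)" if "degree f \<le> 3" for f :: "'a poly"
  proof -
    have "to_fract f = rat_eval [:coeff f 0, coeff f 1, coeff f 2, coeff f 3:] rat_X"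
      using poly_eq_cubic[OF that] by (simp add: rat_eval_X del: rat_eval_pCons)
    thus ?thesis by (simp add: algebra_simps power2_eq_square power3_eq_cube)
  qed
  show ?thesis
  proof (cases "degree h = 0")
    case True
    then obtain d where d: "h = [:d:]" by (auto elim: degree_eq_zeroE)
    hence d0: "d \<noteq> 0" using S(2) by auto
    have "degree g = 3" using rat_degree_Fract_le[OF S(2), of g] deg True S(1,3) by simp
    hence g3: "coeff g 3 \<noteq> 0" by (metis leading_coeff_0_iff degree_0 zero_neq_numeral)
    have "S = rat_const (1 / d) * to_fract g"
      using d0 by (simp add: S(1) d rat_const_def to_fract_def eq_fract)
    also have "\<dots> = rat_const (coeff g 3 / d) * rat_X ^ 3 + rat_const (coeff g 2 / d) * rat_X ^ 2
      + rat_const (coeff g 1 / d) * rat_X + rat_const (coeff g 0 / d)"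
      unfolding eval[OF S(3)] using d0 by (simp add: field_simps)
    finally show ?thesis
      by (rule has_normal_form_cubic[OF three nc, rotated]) (use g3 d0 in simp)
  next
    case False
    define c d where "c = coeff h 1" and "d = coeff h 0"
    have dh: "degree h = 1" using False S(4) by simp
    have c0: "c \<noteq> 0" using dh by (metis c_def leading_coeff_0_iff degree_0 zero_neq_one)
    have h: "h = [:d, c:]" unfolding c_def d_def using S(4)
      by (intro poly_eqI) (auto simp: coeff_pCons coeff_eq_0 split: nat.splits)
    \<comment> \<open>The compositional inverse of \<open>h\<close>, so that the denominator becomes
      \<open>X\<close>.\<close>
    let ?A = "rat_const (1 / c) * rat_X + rat_const (- d / c)"
    define G where "G = pcompose g [:- d / c, 1 / c:]"
    have A: "?A = to_fract [:- d / c, 1 / c:]"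
      by (simp add: rat_const_def rat_X_def to_fract_def)
    have dA: "rat_degree ?A = 1" using c0 by (intro rat_degree_affine) simp
    note ncA = rat_degree_1_nonconst[OF dA]
    have dG: "degree G \<le> 3" using S(3) c0 by (simp add: G_def degree_pcompose)
    have hA: "rat_eval h ?A = rat_X" using c0 by (simp add: h field_simps)
    define T where "T = to_fract G / rat_X"
    have TF: "T = Fract G [:0, 1:]" by (simp add: T_def rat_X_def to_fract_def)
    have "rat_comp S ?A = T" unfolding T_def S(1) rat_comp_Fract[OF S(2) ncA] hA
      unfolding A rat_eval_to_fract G_def ..
    hence eq: "rat_equivalent S T" using rat_equivalent_comp[OF dA nc] by simp
    have ncT: "T \<notin> range rat_const" by (rule rat_equivalent_nonconst[OF eq nc])
    have dT: "rat_degree T = 3" using rat_degree_equivalent[OF eq nc] deg by simp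
    hence "degree G = 3" using rat_degree_Fract_le[of "[:0, 1:]" G] dG by (simp add: TF)
    hence G3: "coeff G 3 \<noteq> 0" by (metis leading_coeff_0_iff degree_0 zero_neq_numeral)
    \<comment> \<open>Otherwise 0 would be a common root of \<open>G\<close> and
      \<open>X\<close>.\<close>
    have G0: "coeff G 0 \<noteq> 0"
      using rat_degree_common_root_less[of "[:0, 1:]" G 0 3] dG dT by (auto simp: TF poly_0_coeff_0)
    \<comment> \<open>Replacing \<open>X\<close> by \<open>t X\<close> makes the cubic and the
      constant coefficient of the numerator equal; division by \<open>t X\<close> and a rescaling
      then leave coefficient 1 at \<open>X ^ 2\<close> and at \<open>1 / X\<close>.\<close>
    obtain t where t: "t ^ 3 = coeff G 0 / coeff G 3"
      using nth_root_exists[of 3 "coeff G 0 / coeff G 3"] by auto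
    have t0: "t \<noteq> 0" using t G0 G3 by auto
    have Gt: "coeff G 3 * t ^ 3 = coeff G 0" using t G3 by simp
    let ?B = "rat_const t * rat_X + rat_const 0"
    define a where "a = coeff G 2 * t ^ 2 / coeff G 0"
    have dB: "rat_degree ?B = 1" using t0 by (rule rat_degree_affine)
    have "rat_X ^ 2 + rat_const a * rat_X + 1 / rat_X =
        rat_const (t / coeff G 0) * rat_comp T ?B + rat_const (- coeff G 1 * t / coeff G 0)"
    proof -
      have "rat_comp T ?B = (rat_const (coeff G 3) * ?B ^ 3 + rat_const (coeff G 2) * ?B ^ 2
          + rat_const (coeff G 1) * ?B + rat_const (coeff G 0)) / ?B"
        unfolding T_def eval[OF dG] by (simp only: rat_comp_simps[OF rat_degree_1_nonconst[OF dB]])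
      also have "rat_const (coeff G 3) * ?B ^ 3 = rat_const (coeff G 0) * rat_X ^ 3"
        unfolding Gt[symmetric] by (simp add: power_mult_distrib)
      finally have TB: "rat_comp T ?B = (rat_const (coeff G 0) * rat_X ^ 3 + rat_const (coeff G 2) * ?B ^ 2
          + rat_const (coeff G 1) * ?B + rat_const (coeff G 0)) / ?B" .
      show ?thesis unfolding TB using t0 G0
        by (simp add: a_def field_simps power2_eq_square power3_eq_cube)
    qed
    hence eq': "rat_equivalent T (rat_X ^ 2 + rat_const a * rat_X + 1 / rat_X)" (is "rat_equivalent T ?Q")
      by (rule rat_equivalent_affine_compI[OF ncT dB, rotated]) (use t0 G0 in simp)
    have "has_normal_form ?Q"
      by (rule has_normal_form_quadratic_plus_pole[OF three rat_equivalent_nonconst[OF eq' ncT] refl])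
    thus ?thesis
      using has_normal_form_equivalent eq eq' nc ncT by blast
  qed
qed

theorem theorem4p4:
  fixes R :: "'a::alg_closed_field poly fract"
  assumes "CHAR('a) = 3"
    and "rat_degree R = 3"
  shows "rat_equivalent R (rat_X ^ 3) \<or>
         rat_equivalent R (rat_X ^ 3 + rat_X ^ 2) \<or>
         rat_equivalent R (rat_X ^ 3 + rat_X) \<or>
         (\<exists>c. c \<notin> range of_int \<and> rat_equivalent R (R_c c))"
proof -
  have three: "(3::'a) = 0" using of_nat_CHAR[where ?'a = 'a] assms(1) by simp
  have R: "R \<notin> range rat_const" using assms(2) rat_degree_nonconst[of R] by simp
  obtain g h where gh: "h \<noteq> 0" "degree g \<le> 3" "degree h \<le> 1" "rat_equivalent R (Fract g h)"
    by (rule rat_equivalent_linear_denominator[OF assms(2)])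
  have "has_normal_form (Fract g h)"
    using has_normal_form_linear_denominator[OF three _ refl gh(1-3)]
      rat_degree_equivalent[OF gh(4) R] assms(2) by simp
  hence "has_normal_form R" by (rule has_normal_form_equivalent[OF gh(4) _ R])
  thus ?thesis by (simp only: has_normal_form_def)
qed

end
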